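(* Let $a$ and $b$ be two disjoint codeblocks, each consisting of finitely many physical fermionic sites. For each $x\in\{a,b\}$ let $\mathcal C_x$ be the code space of block $x$, spanned by two orthonormal codestates $|0\rangle_{\mathrm L},|1\rangle_{\mathrm L}$, with orthogonal projector $P_x$. Assume that for each $x\in\{a,b\}$ both codestates are eigenstates of the total fermion number operator $N_{\mathrm{tot}}^x=\sum_{j\in x} n_j$ of the block, and that the code detects phase errors, i.e. $P_x n_j P_x\propto P_x$ for every site $j$ of block $x$. Then the code has no fermionic logical operators: there do not exist operators $O_a\in\mathcal A_a$, $O_b\in\mathcal A_b$ that are logical, i.e. $(1-P_a)O_aP_a=0$ and $(1-P_b)O_bP_b=0$, that are nonzero on the respective code spaces ($O_aP_a\neq0$, $O_bP_b\neq 0$), and that anticommute on the code space, $$(O_aO_b+O_bO_a)P_aP_b=0 .$$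
   Context: Physical fermions: sites $j$ carry operators $p_j,p_j^\dagger$ with canonical anticommutation relations $\{p_i^\dagger,p_j\}=\delta_{ij}$, $\{p_i,p_j\}=0$ (for sites in the same or in different blocks), acting on the joint Fock space of all sites in $a\cup b$. $n_j=p_j^\dagger p_j$. Majorana operators $\gamma_j,\tilde\gamma_j$ are the self-adjoint operators with $p_j^\dagger=\tfrac12(\gamma_j+i\tilde\gamma_j)$. $\mathcal A_x$ is the complex algebra generated by the Majorana operators of the sites in block $x$; it acts irreducibly on the Fock space $\mathcal F_x$ of block $x$, and an operator on $\mathcal F_x$ is identified with the corresponding element of $\mathcal A_x$, acting on the joint Fock space. In particular $\mathcal C_x\subset\mathcal F_x$ and $P_x\in\mathcal A_x$. An error $E$ is detectable by a code with projector $P$ if $PEP\propto P$ (Knill--Laflamme condition). The codestates $|0\rangle_{\mathrm L},|1\rangle_{\mathrm L}$ represent absence and presence of a logical fermion. Fermionic logical operators are logical operators that anticommute between two codeblocks (when acting on the code space). *)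

theory Defs
  imports "HOL-Analysis.Analysis"
begin

text \<open>
  The joint Fock space of the sites in a finite, linearly ordered type is the space of
  complex amplitudes over occupation sets.  Operators are square matrices over it; the scalar
  operator \<open>c \<cdot> 1\<close> is the library's \<^term>\<open>mat c\<close>, so a scalar multiple is written \<^term>\<open>mat c ** A\<close>.
\<close>

type_synonym 's fock = "complex ^ ('s set)"
type_synonym 's fop = "complex ^ ('s set) ^ ('s set)"

definition braket :: "'s::finite fock \<Rightarrow> 's fock \<Rightarrow> complex"
  where "braket \<phi> \<psi> = (\<Sum>S\<in>UNIV. cnj (\<phi> $ S) * \<psi> $ S)"

definition dagger :: "'s::finite fop \<Rightarrow> 's fop"
  where "dagger A = (\<chi> R S. cnj (A $ S $ R))"

definition anticomm :: "'s::finite fop \<Rightarrow> 's fop \<Rightarrow> 's fop"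
  where "anticomm A B = A ** B + B ** A"

text \<open>
  The sign is the Jordan--Wigner sign with respect to the order of the sites.  The canonical
  anticommutation relations are proved below.
\<close>

definition jw_sign :: "'s::{finite,linorder} \<Rightarrow> 's set \<Rightarrow> complex"
  where "jw_sign j S = (- 1) ^ card {i \<in> S. i < j}"

definition ann :: "'s::{finite,linorder} \<Rightarrow> 's fop"
  where "ann j = (\<chi> R S. if j \<in> S \<and> R = S - {j} then jw_sign j S else 0)"

definition num :: "'s::{finite,linorder} \<Rightarrow> 's fop"
  where "num j = dagger (ann j) ** ann j"

definition total_num :: "'s::{finite,linorder} set \<Rightarrow> 's fop"
  where "total_num x = (\<Sum>j\<in>x. num j)"

definition majorana :: "'s::{finite,linorder} \<Rightarrow> 's fop"
  where "majorana j = ann j + dagger (ann j)"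

definition majorana' :: "'s::{finite,linorder} \<Rightarrow> 's fop"
  where "majorana' j = mat \<i> ** (ann j - dagger (ann j))"

inductive_set block_algebra :: "'s::{finite,linorder} set \<Rightarrow> 's fop set" for x :: "'s set"
  where
    scalar: "mat c \<in> block_algebra x"
  | gamma: "j \<in> x \<Longrightarrow> majorana j \<in> block_algebra x"
  | gamma': "j \<in> x \<Longrightarrow> majorana' j \<in> block_algebra x"
  | add: "A \<in> block_algebra x \<Longrightarrow> B \<in> block_algebra x \<Longrightarrow> A + B \<in> block_algebra x"
  | mult: "A \<in> block_algebra x \<Longrightarrow> B \<in> block_algebra x \<Longrightarrow> A ** B \<in> block_algebra x"

text \<open>
  The Fock space of a block is realised inside the joint Fock space as the states in which
  all sites outside the block are empty.  Operators of the block algebra leave it invariant and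
  act on it as they do on the Fock space of the block alone: on such states the Jordan--Wigner
  sign only counts sites of the block.
\<close>

definition block_fock :: "'s::finite set \<Rightarrow> 's fock set"
  where "block_fock x = {\<psi>. \<forall>S. \<psi> $ S \<noteq> 0 \<longrightarrow> S \<subseteq> x}"

definition codestates :: "'s::finite set \<Rightarrow> 's fock \<Rightarrow> 's fock \<Rightarrow> bool"
  where "codestates x L0 L1 \<longleftrightarrow> L0 \<in> block_fock x \<and> L1 \<in> block_fock x \<and>
    braket L0 L0 = 1 \<and> braket L1 L1 = 1 \<and> braket L0 L1 = 0"

definition code_space :: "'s::finite fock \<Rightarrow> 's fock \<Rightarrow> 's fock set"
  where "code_space L0 L1 = vec.span {L0, L1}"

text \<open>
  The element of the block algebra that is identified with the orthogonal projector of
  \<^term>\<open>block_fock x\<close> onto \<open>C\<close>.  On the joint Fock space it is not the orthogonal projector onto \<open>C\<close>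
  itself, since it does not constrain the sites outside the block.
\<close>

definition is_code_projector :: "'s::{finite,linorder} set \<Rightarrow> 's fock set \<Rightarrow> 's fop \<Rightarrow> bool"
  where "is_code_projector x C P \<longleftrightarrow> P \<in> block_algebra x \<and>
    (\<forall>\<psi>\<in>block_fock x. P *v \<psi> \<in> C \<and> (\<forall>\<phi>\<in>C. braket \<phi> (\<psi> - P *v \<psi>) = 0))"

definition detects :: "'s::finite fop \<Rightarrow> 's fop \<Rightarrow> bool"
  where "detects P E \<longleftrightarrow> (\<exists>c. P ** E ** P = mat c ** P)"

definition logical :: "'s::finite fop \<Rightarrow> 's fop \<Rightarrow> bool"
  where "logical P A \<longleftrightarrow> (mat 1 - P) ** A ** P = 0"

lemma dagger_majorana: "dagger (majorana j) = majorana j"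
  by (simp add: dagger_def majorana_def vec_eq_iff)

lemma mat_mult_nth: "(mat c ** A) $ i $ k = c * A $ i $ k" for A :: "'s::finite fop"
proof -
  have "(mat c ** A) $ i $ k = (\<Sum>l\<in>UNIV. if l = i then c * A $ l $ k else 0)"
    unfolding matrix_matrix_mult_def mat_def vec_lambda_beta by (rule sum.cong) auto
  then show ?thesis by simp
qed

lemma dagger_majorana': "dagger (majorana' j) = majorana' j"
  by (simp add: dagger_def majorana'_def vec_eq_iff mat_mult_nth algebra_simps)

lemma dagger_ann_eq_majorana:
  "dagger (ann j) = mat (1 / 2) ** (majorana j + mat \<i> ** majorana' j)"
  by (simp add: majorana_def majorana'_def vec_eq_iff mat_mult_nth algebra_simps)

lemma jw_sign_square: "jw_sign j S * jw_sign j S = 1"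
  by (simp add: jw_sign_def flip: power_mult_distrib)

lemma jw_sign_Diff:
  assumes "i \<in> S"
  shows "jw_sign j (S - {i}) = (if i < j then - jw_sign j S else jw_sign j S)"
proof (cases "i < j")
  case True
  have "{k \<in> S. k < j} = insert i {k \<in> S - {i}. k < j}" using assms True by auto
  then have "card {k \<in> S. k < j} = Suc (card {k \<in> S - {i}. k < j})" by simp
  with True show ?thesis by (simp add: jw_sign_def)
next
  case False
  then have "{k \<in> S - {i}. k < j} = {k \<in> S. k < j}" by auto
  with False show ?thesis by (simp add: jw_sign_def)
qed

lemma jw_sign_insert:
  assumes "i \<notin> S"
  shows "jw_sign j (insert i S) = (if i < j then - jw_sign j S else jw_sign j S)"
  using jw_sign_Diff[of i "insert i S" j] assms by (auto split: if_splits)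

lemma ann_nth: "ann j $ R $ S = (if j \<in> S \<and> R = S - {j} then jw_sign j S else 0)"
  by (simp add: ann_def)

lemma mult_ann_nth:
  "(A ** ann j) $ R $ T = (if j \<in> T then A $ R $ (T - {j}) * jw_sign j T else 0)"
proof -
  have "(A ** ann j) $ R $ T
      = (\<Sum>S\<in>UNIV. if S = T - {j} then (if j \<in> T then A $ R $ S * jw_sign j T else 0) else 0)"
    unfolding matrix_matrix_mult_def ann_nth vec_lambda_beta by (rule sum.cong) auto
  then show ?thesis by simp
qed

lemma dagger_ann_nth:
  "dagger (ann j) $ R $ S = (if j \<notin> S \<and> R = insert j S then jw_sign j S else 0)"
  by (auto simp: dagger_def ann_def jw_sign_insert) (auto simp: jw_sign_def)

lemma mult_dagger_ann_nth:
  "(A ** dagger (ann j)) $ R $ T = (if j \<notin> T then A $ R $ (insert j T) * jw_sign j T else 0)"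
proof -
  have "(A ** dagger (ann j)) $ R $ T
      = (\<Sum>S\<in>UNIV. if S = insert j T then (if j \<notin> T then A $ R $ S * jw_sign j T else 0) else 0)"
    unfolding matrix_matrix_mult_def dagger_ann_nth vec_lambda_beta by (rule sum.cong) auto
  then show ?thesis by simp
qed

lemma anticomm_ann_ann: "anticomm (ann i) (ann j) = 0"
proof -
  have "(anticomm (ann i) (ann j)) $ R $ T = 0" for R T
  proof (cases "i \<in> T \<and> j \<in> T \<and> i \<noteq> j")
    case True
    moreover have "T - {j} - {i} = T - {i} - {j}" by blast
    moreover have "i < j \<and> \<not> j < i \<or> j < i \<and> \<not> i < j" using True by auto
    ultimately show ?thesis
      by (elim disjE conjE)
        (simp_all add: anticomm_def mult_ann_nth ann_nth jw_sign_Diff)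
  next
    case False
    then show ?thesis by (auto simp: anticomm_def mult_ann_nth ann_nth)
  qed
  then show ?thesis by (simp add: vec_eq_iff)
qed

lemma anticomm_dagger_ann_ann: "anticomm (dagger (ann i)) (ann j) = (if i = j then mat 1 else 0)"
proof -
  have "(anticomm (dagger (ann i)) (ann j)) $ R $ T = (if i = j then mat 1 else 0) $ R $ T" for R T
  proof (cases "i = j")
    case True
    show ?thesis
    proof (cases "j \<in> T")
      case in_T: True
      then have "insert j (T - {j}) = T" by blast
      with in_T True show ?thesis
        by (simp add: anticomm_def mult_ann_nth mult_dagger_ann_nth dagger_ann_nth mat_def
            jw_sign_Diff jw_sign_square)
    next
      case False
      then have "insert j T - {j} = T" by blast
      with False True show ?thesis
        by (simp add: anticomm_def mult_ann_nth mult_dagger_ann_nth ann_nth mat_def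
            jw_sign_insert jw_sign_square)
    qed
  next
    case False
    show ?thesis
    proof (cases "i \<notin> T \<and> j \<in> T")
      case True
      moreover from False have "insert i T - {j} = insert i (T - {j})" by blast
      moreover have "i < j \<and> \<not> j < i \<or> j < i \<and> \<not> i < j" using False by auto
      ultimately show ?thesis using False
        by (elim disjE conjE)
          (simp_all add: anticomm_def mult_ann_nth mult_dagger_ann_nth dagger_ann_nth ann_nth
            jw_sign_Diff jw_sign_insert)
    next
      case no: False
      with False show ?thesis
        by (auto simp: anticomm_def mult_ann_nth mult_dagger_ann_nth dagger_ann_nth ann_nth)
    qed
  qed
  then show ?thesis by (simp add: vec_eq_iff)
qed

end

theory Submission
  imports Defs
begin

text \<open>
  Compressing \<open>n\<^sub>j\<close> to the code space and summing over \<open>j\<close> shows that the total number operator acts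
  as a scalar there, so both codestates carry the same particle number.  Hence \<open>P\<close> and \<open>O P = P O P\<close>
  conserve the particle number of the block; in particular they have even parity and commute with
  the algebra of the other block.  The anticommutator on the code space is therefore
  \<open>2 (O\<^sub>a P\<^sub>a) (O\<^sub>b P\<^sub>b)\<close>, and a product of nonzero elements of the two block algebras is
  nonzero.
\<close>

section \<open>Matrix entries of the block algebra\<close>

text \<open>
  The Jordan--Wigner sign picked up when the operators creating \<open>V\<close> are moved past those creating
  \<open>U\<close>.
\<close>

definition exchange_sign :: "'s::{finite,linorder} set \<Rightarrow> 's set \<Rightarrow> complex"
  where "exchange_sign U V = (\<Prod>v\<in>V. jw_sign v U)"

lemma exchange_sign_square: "exchange_sign U V * exchange_sign U V = 1"
  by (simp add: exchange_sign_def jw_sign_square flip: prod.distrib)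

lemma exchange_sign_nonzero: "exchange_sign U V \<noteq> 0"
  using exchange_sign_square[of U V] by auto

lemma cnj_exchange_sign: "cnj (exchange_sign U V) = exchange_sign U V"
  by (simp add: exchange_sign_def jw_sign_def)

text \<open>
  \<open>A\<close> acts as \<open>B \<otimes> 1\<close> for an operator \<open>B\<close> of the block \<open>x\<close>, up to the signs from moving operators of
  the block past the sites outside it.  Such an \<open>A\<close> is determined by its entries inside \<open>x\<close>.
\<close>

definition block_local :: "'s::{finite,linorder} set \<Rightarrow> 's fop \<Rightarrow> bool"
  where "block_local x A \<longleftrightarrow> (\<forall>R S. A $ R $ S =
    (if R - x = S - x
     then exchange_sign (S - x) (R \<inter> x) * exchange_sign (S - x) (S \<inter> x) * A $ (R \<inter> x) $ (S \<inter> x)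
     else 0))"

lemma block_localD:
  assumes "block_local x A"
  shows "A $ R $ S = (if R - x = S - x
     then exchange_sign (S - x) (R \<inter> x) * exchange_sign (S - x) (S \<inter> x) * A $ (R \<inter> x) $ (S \<inter> x)
     else 0)"
  using assms unfolding block_local_def by blast

lemma block_local_outside:
  assumes "block_local x A" "A $ R $ S \<noteq> 0"
  shows "R - x = S - x"
  using assms block_localD[of x A R S] by (auto split: if_splits)

lemma block_local_inside:
  assumes "block_local x A" "A $ R $ S \<noteq> 0"
  shows "A $ (R \<inter> x) $ (S \<inter> x) \<noteq> 0"
  using assms block_localD[of x A R S] by (auto split: if_splits)

lemma block_local_nonzero:
  assumes "block_local x A" "R - x = S - x" "A $ (R \<inter> x) $ (S \<inter> x) \<noteq> 0"
  shows "A $ R $ S \<noteq> 0"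
  using assms block_localD[of x A R S] by (simp add: exchange_sign_nonzero)

lemma block_local_mat: "block_local x (mat c)"
proof -
  have "R = S" if "R - x = S - x" "R \<inter> x = S \<inter> x" for R S
    using that by (metis Un_Diff_Int)
  then show ?thesis
    by (auto simp: block_local_def mat_def exchange_sign_square)
qed

lemma block_local_add:
  assumes "block_local x A" "block_local x B"
  shows "block_local x (A + B)"
  unfolding block_local_def
proof (intro allI)
  fix R S
  show "(A + B) $ R $ S = (if R - x = S - x
     then exchange_sign (S - x) (R \<inter> x) * exchange_sign (S - x) (S \<inter> x) * (A + B) $ (R \<inter> x) $ (S \<inter> x)
     else 0)"
    using block_localD[OF assms(1), of R S] block_localD[OF assms(2), of R S]
    by (simp add: distrib_left)
qed

lemma block_local_dagger:
  assumes "block_local x A"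
  shows "block_local x (dagger A)"
  unfolding block_local_def
proof (intro allI)
  fix R S
  show "dagger A $ R $ S = (if R - x = S - x
     then exchange_sign (S - x) (R \<inter> x) * exchange_sign (S - x) (S \<inter> x) * dagger A $ (R \<inter> x) $ (S \<inter> x)
     else 0)"
    using block_localD[OF assms, of S R] by (simp add: dagger_def cnj_exchange_sign)
qed

text \<open>Every intermediate occupation set \<open>T\<close> that contributes agrees with
  \<open>S\<close> outside \<open>x\<close>. Its exchange sign enters once from each factor and
  squares to one, so what is left is the product inside the block.\<close>

lemma block_local_mult:
  assumes "block_local x A" "block_local x B"
  shows "block_local x (A ** B)"
  unfolding block_local_def
proof (intro allI)
  fix R S
  let ?e = "\<lambda>V. exchange_sign (S - x) (V \<inter> x)"
  show "(A ** B) $ R $ S = (if R - x = S - x then ?e R * ?e S * (A ** B) $ (R \<inter> x) $ (S \<inter> x) else 0)"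
  proof (cases "R - x = S - x")
    case False
    then have "(\<Sum>T\<in>UNIV. A $ R $ T * B $ T $ S) = 0"
      using block_local_outside[OF assms(1)] block_local_outside[OF assms(2)]
      by (intro sum.neutral) (metis mult_eq_0_iff)
    with False show ?thesis by (simp add: matrix_matrix_mult_def)
  next
    case True
    have "(A ** B) $ R $ S = (\<Sum>T\<in>UNIV. A $ R $ T * B $ T $ S)"
      by (simp add: matrix_matrix_mult_def)
    also have "\<dots> = (\<Sum>T\<in>{T. T - x = S - x}. A $ R $ T * B $ T $ S)"
      by (rule sum.mono_neutral_right) (auto dest: block_local_outside[OF assms(2)])
    also have "\<dots> = (\<Sum>T\<in>{T. T - x = S - x}.
        ?e R * ?e S * (A $ (R \<inter> x) $ (T \<inter> x) * B $ (T \<inter> x) $ (S \<inter> x)))"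
    proof (rule sum.cong)
      fix T assume "T \<in> {T. T - x = S - x}"
      then have T: "T - x = S - x" by simp
      have "A $ R $ T * B $ T $ S
          = (?e T * ?e T) * (?e R * ?e S * (A $ (R \<inter> x) $ (T \<inter> x) * B $ (T \<inter> x) $ (S \<inter> x)))"
        using block_localD[OF assms(1), of R T] block_localD[OF assms(2), of T S] T True by simp
      then show "A $ R $ T * B $ T $ S
          = ?e R * ?e S * (A $ (R \<inter> x) $ (T \<inter> x) * B $ (T \<inter> x) $ (S \<inter> x))"
        by (simp add: exchange_sign_square)
    qed simp
    also have "\<dots> = ?e R * ?e S * (\<Sum>T\<in>{T. T - x = S - x}. A $ (R \<inter> x) $ (T \<inter> x) * B $ (T \<inter> x) $ (S \<inter> x))"
      by (simp add: sum_distrib_left)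
    also have "(\<Sum>T\<in>{T. T - x = S - x}. A $ (R \<inter> x) $ (T \<inter> x) * B $ (T \<inter> x) $ (S \<inter> x))
        = (\<Sum>T\<in>Pow x. A $ (R \<inter> x) $ T * B $ T $ (S \<inter> x))"
      \<comment> \<open>With the outside part frozen to \<open>S - x\<close>, a set \<open>T\<close>
        is the same datum as its part inside \<open>x\<close>.\<close>
      by (rule sum.reindex_bij_witness[of _ "\<lambda>T. T \<union> (S - x)" "\<lambda>T. T \<inter> x"]) auto
    \<comment> \<open>Sets reaching outside \<open>x\<close> add nothing, since \<open>B\<close>
      cannot change the empty outside part of \<open>S \<inter> x\<close>.\<close>
    also have "\<dots> = (\<Sum>T\<in>UNIV. A $ (R \<inter> x) $ T * B $ T $ (S \<inter> x))"
      by (rule sum.mono_neutral_left) (auto dest!: block_local_outside[OF assms(2)])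
    also have "\<dots> = (A ** B) $ (R \<inter> x) $ (S \<inter> x)"
      by (simp add: matrix_matrix_mult_def)
    finally show ?thesis using True by simp
  qed
qed

text \<open>The Jordan-Wigner sign at \<open>j\<close> factors into a count over sites outside
  \<open>x\<close> and one over sites inside. The outside factor is exactly the quotient of the
  exchange signs before and after \<open>j\<close> is removed.\<close>

lemma block_local_ann:
  assumes "j \<in> x"
  shows "block_local x (ann j)"
  unfolding block_local_def
proof (intro allI)
  fix R S
  let ?U = "S - x"
  show "ann j $ R $ S = (if R - x = S - x
    then exchange_sign ?U (R \<inter> x) * exchange_sign ?U (S \<inter> x) * ann j $ (R \<inter> x) $ (S \<inter> x) else 0)"
  proof (cases "j \<in> S \<and> R = S - {j}")
    case True
    with assms have eq: "R - x = S - x" "R \<inter> x = S \<inter> x - {j}" by auto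
    have "exchange_sign ?U (S \<inter> x) = jw_sign j ?U * exchange_sign ?U (R \<inter> x)"
      unfolding exchange_sign_def eq(2) using True assms by (intro prod.remove) auto
    moreover have "jw_sign j S = jw_sign j ?U * jw_sign j (S \<inter> x)"
    proof -
      have "card {i \<in> S. i < j} = card {i \<in> ?U. i < j} + card {i \<in> S \<inter> x. i < j}"
        by (subst card_Un_disjoint[symmetric]) (auto intro!: arg_cong[of _ _ card])
      then show ?thesis by (simp add: jw_sign_def power_add)
    qed
    ultimately show ?thesis
      using True assms eq exchange_sign_square[of ?U "R \<inter> x"] by (simp add: ann_nth)
  next
    case False
    have "\<not> (j \<in> S \<inter> x \<and> R \<inter> x = S \<inter> x - {j})" if "R - x = S - x"
      using that False assms by blast
    with False show ?thesis by (auto simp: ann_nth)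
  qed
qed

lemma matrix_minus_eq: "A - B = A + mat (- 1) ** B" for A B :: "'s::finite fop"
  by (simp add: vec_eq_iff mat_mult_nth)

lemma block_algebra_local:
  assumes "A \<in> block_algebra x"
  shows "block_local x A"
  using assms
proof induction
  case (gamma j)
  then show ?case
    unfolding majorana_def by (intro block_local_add block_local_dagger block_local_ann)
next
  case (gamma' j)
  then show ?case
    unfolding majorana'_def matrix_minus_eq
    by (intro block_local_add block_local_mult block_local_mat block_local_dagger block_local_ann)
qed (auto intro: block_local_mat block_local_add block_local_mult)

text \<open>A nonzero entry preserves the occupation outside \<open>x\<close>, so empty outside
  sites stay empty. This allows the defining property of the projector, which speaks only of
  \<open>block_fock x\<close>, to be applied after another block operator.\<close>

lemma block_fock_invariant:
  assumes "block_local x A" "\<psi> \<in> block_fock x"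
  shows "A *v \<psi> \<in> block_fock x"
  unfolding block_fock_def
proof (intro CollectI allI impI)
  fix R assume "(A *v \<psi>) $ R \<noteq> 0"
  then obtain S where "A $ R $ S * \<psi> $ S \<noteq> 0"
    by (auto simp: matrix_vector_mult_def elim: sum.not_neutral_contains_not_neutral)
  then show "R \<subseteq> x"
    using block_local_outside[OF assms(1), of R S] assms(2) by (auto simp: block_fock_def)
qed

text \<open>This mirrors the fact that a tensor product of nonzero operators is nonzero: an entry of
  \<open>X ** Y\<close> is exhibited whose defining sum has a single term, a product of one nonzero
  entry from each factor.\<close>

lemma block_local_product_nonzero:
  assumes "block_local a X" "block_local b Y" and ab: "a \<inter> b = {}" "a \<union> b = UNIV"
    and "X \<noteq> 0" "Y \<noteq> 0"
  shows "X ** Y \<noteq> 0"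
proof -
  obtain R S where "X $ R $ S \<noteq> 0" using \<open>X \<noteq> 0\<close> by (auto simp: vec_eq_iff)
  then have X: "X $ (R \<inter> a) $ (S \<inter> a) \<noteq> 0" by (rule block_local_inside[OF assms(1)])
  obtain R' S' where "Y $ R' $ S' \<noteq> 0" using \<open>Y \<noteq> 0\<close> by (auto simp: vec_eq_iff)
  then have Y: "Y $ (R' \<inter> b) $ (S' \<inter> b) \<noteq> 0" by (rule block_local_inside[OF assms(2)])
  \<comment> \<open>\<open>Y\<close> acts first, taking the \<open>b\<close> part from
    \<open>S'\<close> to \<open>R'\<close>; then \<open>X\<close> takes the \<open>a\<close> part
    from \<open>S\<close> to \<open>R\<close>. In between, the \<open>a\<close> part is still that
    of \<open>S\<close> and the \<open>b\<close> part is already that of \<open>R'\<close>.\<close>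
  define R2 S2 T2 where "R2 = (R \<inter> a) \<union> (R' \<inter> b)" and "S2 = (S \<inter> a) \<union> (S' \<inter> b)"
    and "T2 = (S \<inter> a) \<union> (R' \<inter> b)"
  note defs = R2_def S2_def T2_def
  have "(X ** Y) $ R2 $ S2 = (\<Sum>T\<in>UNIV. X $ R2 $ T * Y $ T $ S2)"
    by (simp add: matrix_matrix_mult_def)
  also have "\<dots> = (\<Sum>T\<in>{T2}. X $ R2 $ T * Y $ T $ S2)"
  proof (rule sum.mono_neutral_right)
    show "\<forall>T\<in>UNIV - {T2}. X $ R2 $ T * Y $ T $ S2 = 0"
    proof
      fix T assume T: "T \<in> UNIV - {T2}"
      \<comment> \<open>\<open>X\<close> fixes \<open>T\<close> off \<open>a\<close> and
        \<open>Y\<close> fixes it off \<open>b\<close>; as the blocks are disjoint, every site lies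
        off one of them.\<close>
      have "T = T2" if "R2 - a = T - a" "T - b = S2 - b"
      proof -
        have "x \<in> a \<and> x \<notin> b \<or> x \<notin> a \<and> x \<in> b" for x using ab by blast
        then show ?thesis using that unfolding defs by blast
      qed
      then show "X $ R2 $ T * Y $ T $ S2 = 0"
        using T block_local_outside[OF assms(1), of R2 T] block_local_outside[OF assms(2), of T S2]
        by auto
    qed
  qed auto
  also have "\<dots> = X $ R2 $ T2 * Y $ T2 $ S2" by simp
  also have "\<dots> \<noteq> 0"
  proof -
    have "R2 - a = T2 - a" "R2 \<inter> a = R \<inter> a" "T2 \<inter> a = S \<inter> a"
      "T2 - b = S2 - b" "T2 \<inter> b = R' \<inter> b" "S2 \<inter> b = S' \<inter> b"
      using ab unfolding defs by blast+
    then have "X $ R2 $ T2 \<noteq> 0" "Y $ T2 $ S2 \<noteq> 0"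
      using X Y block_local_nonzero[OF assms(1), of R2 T2] block_local_nonzero[OF assms(2), of T2 S2]
      by simp_all
    then show ?thesis by simp
  qed
  finally show ?thesis by auto
qed

section \<open>Even elements commute with the other block\<close>

text \<open>Conjugation by the fermion parity operator of the block \<open>x\<close>.\<close>

definition parity_twist :: "'s::finite set \<Rightarrow> 's fop \<Rightarrow> 's fop"
  where "parity_twist x A = (\<chi> R S. (- 1) ^ (card (R \<inter> x) + card (S \<inter> x)) * A $ R $ S)"

lemma parity_twist_mat: "parity_twist x (mat c) = mat c"
  by (auto simp: parity_twist_def mat_def vec_eq_iff)

lemma parity_twist_add: "parity_twist x (A + B) = parity_twist x A + parity_twist x B"
  by (simp add: parity_twist_def vec_eq_iff distrib_left)

text \<open>Conjugation by a diagonal matrix of signs is multiplicative: the sign of the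
  intermediate set occurs twice and cancels.\<close>

lemma parity_twist_mult: "parity_twist x (A ** B) = parity_twist x A ** parity_twist x B"
proof -
  have "(-1) ^ (r + s) * (u * v) = ((-1) ^ (r + t) * u) * ((-1) ^ (t + s) * v)"
    for r s t :: nat and u v :: complex
  proof -
    have "(-1 :: complex) ^ t * (-1) ^ t = 1" by (simp flip: power_mult_distrib)
    moreover have "((-1) ^ (r + t) * u) * ((-1) ^ (t + s) * v)
      = ((-1) ^ t * (-1) ^ t) * ((-1) ^ (r + s) * (u * v))"
      by (simp only: power_add ac_simps)
    ultimately show ?thesis by (simp only: mult_1_left)
  qed
  then show ?thesis
    unfolding parity_twist_def vec_eq_iff matrix_matrix_mult_def vec_lambda_beta sum_distrib_left
    by (intro allI sum.cong refl)
qed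

lemma parity_twist_ann:
  assumes "j \<in> x"
  shows "parity_twist x (ann j) = - ann j"
proof -
  have "(- 1 :: complex) ^ (card ((S - {j}) \<inter> x) + card (S \<inter> x)) = - 1" if "j \<in> S" for S
  proof -
    have eq: "(S - {j}) \<inter> x = S \<inter> x - {j}" by blast
    have "card (S \<inter> x) = Suc (card ((S - {j}) \<inter> x))"
      unfolding eq using that assms by (intro card.remove) auto
    then show ?thesis by simp
  qed
  then show ?thesis by (auto simp: parity_twist_def vec_eq_iff ann_nth)
qed

lemma parity_twist_dagger: "parity_twist x (dagger A) = dagger (parity_twist x A)"
  by (simp add: parity_twist_def dagger_def vec_eq_iff add.commute)

section \<open>Exchanging ladder operators with block operators\<close>

lemma dagger_minus: "dagger (- A) = - dagger A"
  by (simp add: dagger_def vec_eq_iff)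

lemma dagger_mult: "dagger (A ** B) = dagger B ** dagger A"
  by (simp add: dagger_def vec_eq_iff matrix_matrix_mult_def mult.commute)

lemma dagger_add: "dagger (A + B) = dagger A + dagger B"
  by (simp add: dagger_def vec_eq_iff)

lemma mult_mat: "A ** mat c = mat c ** A" for A :: "'s::finite fop"
proof -
  have "(A ** mat c) $ i $ k = c * A $ i $ k" for i k
  proof -
    have "(A ** mat c) $ i $ k = (\<Sum>l\<in>UNIV. if l = k then c * A $ i $ l else 0)"
      unfolding matrix_matrix_mult_def mat_def vec_lambda_beta by (rule sum.cong) auto
    then show ?thesis by simp
  qed
  then show ?thesis by (simp add: vec_eq_iff mat_mult_nth)
qed

lemma matrix_add_rdistrib: "(A + B) ** C = A ** C + B ** C" for A B C :: "'s::finite fop"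
  by (simp add: matrix_matrix_mult_def vec_eq_iff distrib_right sum.distrib)

lemma matrix_mult_minus_left: "(- A) ** B = - (A ** B)" for A B :: "'s::finite fop"
  by (simp add: matrix_matrix_mult_def vec_eq_iff sum_negf)

lemma matrix_mult_zero [simp]: "0 ** A = 0" "A ** 0 = 0" for A :: "'s::finite fop"
  by (simp_all add: matrix_matrix_mult_def vec_eq_iff)

text \<open>The relation for two creation operators is the adjoint of that for two annihilation
  operators. The minus sign is attached to \<open>A\<close> to match the twist of a ladder operator
  in \<open>parity_twist_ann\<close>.\<close>

lemma ann_anticommute:
  assumes "i \<noteq> j" and "A \<in> {ann i, dagger (ann i)}" "B \<in> {ann j, dagger (ann j)}"
  shows "B ** A = - A ** B"
proof -
  have "dagger (anticomm (ann i) (ann j)) = 0"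
    unfolding anticomm_ann_ann by (simp add: dagger_def vec_eq_iff)
  then have "anticomm (dagger (ann i)) (dagger (ann j)) = 0"
    by (simp add: anticomm_def dagger_add dagger_mult add.commute)
  moreover have "anticomm (ann i) (dagger (ann j)) = 0"
    using assms(1) anticomm_dagger_ann_ann[of j i] by (simp add: anticomm_def add.commute)
  ultimately have "A ** B + B ** A = 0"
    using assms anticomm_ann_ann[of i j] anticomm_dagger_ann_ann[of i j]
    by (auto simp: anticomm_def)
  then show ?thesis
    by (simp add: matrix_mult_minus_left eq_neg_iff_add_eq_0 add.commute)
qed

text \<open>Moving \<open>B\<close> past each ladder operator of the block costs one sign, which the
  twist records. The relation is stable under sums and products, so it suffices to check scalars and
  ladder operators.\<close>

lemma parity_twist_intertwines:
  assumes "A \<in> block_algebra x" "j \<notin> x" and B: "B \<in> {ann j, dagger (ann j)}"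
  shows "B ** A = parity_twist x A ** B"
proof -
  define I where "I A \<longleftrightarrow> B ** A = parity_twist x A ** B" for A
  have mat: "I (mat c)" for c
    by (simp add: I_def parity_twist_mat mult_mat)
  have add: "I (U + V)" if "I U" "I V" for U V
    using that by (simp add: I_def parity_twist_add matrix_add_ldistrib matrix_add_rdistrib)
  have mult: "I (U ** V)" if "I U" "I V" for U V
    using that unfolding I_def by (metis parity_twist_mult matrix_mul_assoc)
  have ann: "I (ann i)" "I (dagger (ann i))" if "i \<in> x" for i
  proof -
    have "i \<noteq> j" using that assms(2) by blast
    then show "I (ann i)" "I (dagger (ann i))"
      using that ann_anticommute[OF _ _ B, of i]
      by (simp_all add: I_def parity_twist_ann parity_twist_dagger dagger_minus)
  qed
  have "I A"
    using assms(1)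
  proof induction
    case (gamma i)
    then show ?case unfolding majorana_def by (intro add ann)
  next
    case (gamma' i)
    then show ?case unfolding majorana'_def matrix_minus_eq by (intro mult add mat ann)
  qed (auto intro: mat add mult)
  then show ?thesis by (simp add: I_def)
qed

text \<open>For even \<open>X\<close> the intertwining relation becomes commutation with the ladder
  operators of \<open>y\<close>. The operators commuting with \<open>X\<close> are closed under sums
  and products, hence include the whole algebra of \<open>y\<close>.\<close>

lemma even_commutes:
  assumes X: "X \<in> block_algebra x" "parity_twist x X = X" and "x \<inter> y = {}" "B \<in> block_algebra y"
  shows "B ** X = X ** B"
proof -
  define I where "I B \<longleftrightarrow> B ** X = X ** B" for B
  have mat: "I (mat c)" for c
    by (simp add: I_def mult_mat)
  have add: "I (U + V)" if "I U" "I V" for U V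
    using that by (simp add: I_def matrix_add_ldistrib matrix_add_rdistrib)
  have mult: "I (U ** V)" if "I U" "I V" for U V
    using that unfolding I_def by (metis matrix_mul_assoc)
  have ann: "I (ann j)" "I (dagger (ann j))" if "j \<in> y" for j
    using that assms(3) parity_twist_intertwines[OF X(1), of j] X(2) by (auto simp: I_def)
  have "I B"
    using assms(4)
  proof induction
    case (gamma i)
    then show ?case unfolding majorana_def by (intro add ann)
  next
    case (gamma' i)
    then show ?case unfolding majorana'_def matrix_minus_eq by (intro mult add mat ann)
  qed (auto intro: mat add mult)
  then show ?thesis by (simp add: I_def)
qed

section \<open>Phase-error detection fixes the particle number\<close>

lemma num_nth: "num j $ R $ S = (if R = S \<and> j \<in> S then 1 else 0)"
  by (auto simp: num_def mult_ann_nth dagger_ann_nth jw_sign_Diff jw_sign_square)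

lemma total_num_nth: "total_num x $ R $ S = (if R = S then of_nat (card (S \<inter> x)) else 0)"
proof -
  have "total_num x $ R $ S = (\<Sum>j\<in>x. num j $ R $ S)"
    by (simp add: total_num_def)
  also have "\<dots> = (\<Sum>j\<in>x. if R = S \<and> j \<in> S then 1 else 0)"
    by (simp add: num_nth)
  also have "\<dots> = (if R = S then of_nat (card (S \<inter> x)) else 0)"
    by (auto simp: Int_commute sum.inter_restrict[symmetric])
  finally show ?thesis .
qed

lemma total_num_apply: "(total_num x *v \<psi>) $ S = of_nat (card (S \<inter> x)) * \<psi> $ S"
proof -
  have "(total_num x *v \<psi>) $ S
      = (\<Sum>T\<in>UNIV. if T = S then of_nat (card (S \<inter> x)) * \<psi> $ S else 0)"
    unfolding matrix_vector_mult_def vec_lambda_beta total_num_nth by (rule sum.cong) auto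
  then show ?thesis by simp
qed

lemma mat_mult_vector: "(mat c ** A) *v \<psi> = c *s (A *v \<psi>)" for A :: "'s::finite fop"
  by (simp add: vec_eq_iff matrix_vector_mult_def mat_mult_nth sum_distrib_left mult.assoc)

text \<open>The Knill-Laflamme constants add, which carries detection from the single
  \<open>num j\<close> over to \<open>total_num x\<close>.\<close>

lemma detects_sum:
  assumes "finite J" "\<And>j. j \<in> J \<Longrightarrow> detects P (E j)"
  shows "detects P (\<Sum>j\<in>J. E j)"
  using assms
proof (induction J)
  case empty
  have "P ** 0 ** P = mat 0 ** P" by simp
  then show ?case unfolding detects_def by (metis sum.empty)
next
  case (insert i J)
  then obtain c d where "P ** E i ** P = mat c ** P" "P ** sum E J ** P = mat d ** P"
    unfolding detects_def by blast
  then have "P ** sum E (insert i J) ** P = mat (c + d) ** P"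
    using insert.hyps
    by (simp add: matrix_add_ldistrib matrix_add_rdistrib vec_eq_iff mat_mult_nth distrib_right)
  then show ?case unfolding detects_def by blast
qed

section \<open>Codestates and the code projector\<close>

lemma braket_self_eq_0:
  assumes "braket \<phi> \<phi> = 0"
  shows "\<phi> = 0"
proof -
  have "braket \<phi> \<phi> = of_real (\<Sum>S\<in>UNIV. (cmod (\<phi> $ S))\<^sup>2)"
    by (simp add: braket_def complex_norm_square mult.commute del: of_real_power)
  then have "(\<Sum>S\<in>UNIV. (cmod (\<phi> $ S))\<^sup>2) = 0"
    using assms by (metis of_real_eq_0_iff)
  then show ?thesis by (simp add: sum_nonneg_eq_0_iff vec_eq_iff)
qed

lemma braket_axis: "braket \<phi> (axis S 1) = cnj (\<phi> $ S)"
proof -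
  have "braket \<phi> (axis S 1) = (\<Sum>T\<in>UNIV. if T = S then cnj (\<phi> $ S) else 0)"
    unfolding braket_def axis_def by (rule sum.cong) auto
  then show ?thesis by simp
qed

lemma subspace_block_fock: "vec.subspace (block_fock x)"
proof -
  have "x' + y' \<noteq> 0 \<Longrightarrow> x' \<noteq> 0 \<or> y' \<noteq> 0" for x' y' :: complex by auto
  then show ?thesis unfolding vec.subspace_def block_fock_def by fastforce
qed

lemma code_space_block_fock:
  assumes "codestates x L0 L1"
  shows "code_space L0 L1 \<subseteq> block_fock x"
  unfolding code_space_def using assms
  by (intro vec.span_minimal subspace_block_fock) (auto simp: codestates_def)

text \<open>The residual \<open>\<phi> - P *v \<phi>\<close> lies in the code space and is
  orthogonal to it, hence to itself.\<close>

lemma projector_fixes: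
  assumes "is_code_projector x (code_space L0 L1) P" "codestates x L0 L1" "\<phi> \<in> code_space L0 L1"
  shows "P *v \<phi> = \<phi>"
proof -
  have "\<phi> \<in> block_fock x" using assms code_space_block_fock by blast
  then have P: "P *v \<phi> \<in> code_space L0 L1"
    and orth: "\<And>\<xi>. \<xi> \<in> code_space L0 L1 \<Longrightarrow> braket \<xi> (\<phi> - P *v \<phi>) = 0"
    using assms(1) by (auto simp: is_code_projector_def)
  have "\<phi> - P *v \<phi> \<in> code_space L0 L1"
    using P assms(3) unfolding code_space_def by (rule vec.span_diff[rotated])
  then have "\<phi> - P *v \<phi> = 0" by (intro braket_self_eq_0 orth)
  then show ?thesis by simp
qed

text \<open>\<open>P *v \<psi>\<close> is a code vector, so it is orthogonal both to
  \<open>\<psi>\<close> and to \<open>\<psi> - P *v \<psi>\<close>, hence to itself.\<close>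

lemma projector_kills:
  assumes "is_code_projector x C P" "\<psi> \<in> block_fock x" "\<And>\<phi>. \<phi> \<in> C \<Longrightarrow> braket \<phi> \<psi> = 0"
  shows "P *v \<psi> = 0"
proof (rule braket_self_eq_0)
  have diff: "braket \<phi> (\<psi> - \<xi>) = braket \<phi> \<psi> - braket \<phi> \<xi>" for \<phi> \<xi>
    by (simp add: braket_def right_diff_distrib sum_subtractf)
  show "braket (P *v \<psi>) (P *v \<psi>) = 0"
    using assms diff[of "P *v \<psi>" "P *v \<psi>"] by (auto simp: is_code_projector_def)
qed

text \<open>Evaluating \<open>P ** total_num x ** P = mat c ** P\<close> on a codestate identifies
  its eigenvalue with the common constant \<open>c\<close>. The total number is diagonal in the
  occupation basis, so \<open>c\<close> counts the sites of every set in the support of a code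
  vector.\<close>

lemma code_space_particle_number:
  assumes "codestates x L0 L1" "is_code_projector x (code_space L0 L1) P"
    and "total_num x *v L0 = m0 *s L0" "total_num x *v L1 = m1 *s L1"
    and "\<And>j. j \<in> x \<Longrightarrow> detects P (num j)"
  obtains c :: complex
    where "\<And>\<phi> S. \<phi> \<in> code_space L0 L1 \<Longrightarrow> \<phi> $ S \<noteq> 0 \<Longrightarrow> S \<subseteq> x \<and> of_nat (card S) = c"
proof -
  have "detects P (total_num x)"
    unfolding total_num_def using assms(5) by (intro detects_sum) auto
  then obtain c where c: "P ** total_num x ** P = mat c ** P"
    unfolding detects_def by blast
  have eig: "total_num x *v L = c *s L"
    if "L \<in> code_space L0 L1" "total_num x *v L = m *s L" for L m
  proof -
    have "P *v L = L" by (rule projector_fixes[OF assms(2,1) that(1)])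
    then have "(P ** total_num x ** P) *v L = m *s L"
      using that(2) by (simp add: matrix_vector_mul_assoc[symmetric] vec.scale)
    moreover have "(mat c ** P) *v L = c *s L"
      using \<open>P *v L = L\<close> by (simp add: mat_mult_vector)
    ultimately show ?thesis using c that(2) by metis
  qed
  have "L0 \<in> code_space L0 L1" "L1 \<in> code_space L0 L1"
    by (simp_all add: code_space_def vec.span_base)
  then have "{L0, L1} \<subseteq> {\<phi>. total_num x *v \<phi> = c *s \<phi>}"
    using eig assms(3,4) by blast
  \<comment> \<open>The eigenspace for \<open>c\<close> contains both codestates, and therefore
    their span.\<close>
  moreover have "vec.subspace {\<phi>. total_num x *v \<phi> = c *s \<phi>}"
    by (auto simp: vec.subspace_def vec.add vec.scale vector_add_ldistrib vector_smult_assoc mult.commute)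
  ultimately have C: "code_space L0 L1 \<subseteq> {\<phi>. total_num x *v \<phi> = c *s \<phi>}"
    unfolding code_space_def by (rule vec.span_minimal)
  show ?thesis
  proof
    fix \<phi> S assume \<phi>: "\<phi> \<in> code_space L0 L1" "\<phi> $ S \<noteq> 0"
    then have "S \<subseteq> x"
      using code_space_block_fock[OF assms(1)] by (auto simp: block_fock_def)
    have "total_num x *v \<phi> = c *s \<phi>" using C \<phi>(1) by blast
    then have "(total_num x *v \<phi>) $ S = c * \<phi> $ S" by simp
    then have "of_nat (card S) = c"
      using \<phi>(2) Int_absorb2[OF \<open>S \<subseteq> x\<close>] by (simp add: total_num_apply)
    with \<open>S \<subseteq> x\<close> show "S \<subseteq> x \<and> of_nat (card S) = c" ..
  qed
qed

text \<open>Such an \<open>X\<close> even conserves the particle number: for a nonzero entry, both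
  the row and the column, cut down to \<open>x\<close>, lie in the support of code vectors, so both
  have \<open>c\<close> elements.\<close>

lemma even_on_code_space:
  fixes c :: complex
  assumes X: "block_local x X"
    and P: "is_code_projector x C P"
    and C: "\<And>\<phi> S. \<phi> \<in> C \<Longrightarrow> \<phi> $ S \<noteq> 0 \<Longrightarrow> S \<subseteq> x \<and> of_nat (card S) = c"
    and range: "\<And>\<psi>. \<psi> \<in> block_fock x \<Longrightarrow> X *v \<psi> \<in> C"
    and kernel: "\<And>\<psi>. P *v \<psi> = 0 \<Longrightarrow> X *v \<psi> = 0"
  shows "parity_twist x X = X"
proof -
  have "card (R \<inter> x) = card (S \<inter> x)" if "X $ R $ S \<noteq> 0" for R S
  proof -
    \<comment> \<open>Locality moves the nonzero entry to \<open>R \<inter> x\<close>,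
      \<open>S \<inter> x\<close>, so it can be tested on a basis vector of the block's Fock
      space.\<close>
    let ?e = "axis (S \<inter> x) 1"
    have e: "?e \<in> block_fock x" by (auto simp: block_fock_def axis_def split: if_splits)
    have "(X *v ?e) $ (R \<inter> x)
        = (\<Sum>T\<in>UNIV. if T = S \<inter> x then X $ (R \<inter> x) $ (S \<inter> x) else 0)"
      unfolding matrix_vector_mult_def axis_def vec_lambda_beta by (rule sum.cong) auto
    then have nz: "(X *v ?e) $ (R \<inter> x) \<noteq> 0"
      using block_local_inside[OF X that] by simp
    then have R: "of_nat (card (R \<inter> x)) = c" using C range[OF e] by blast
    \<comment> \<open>If \<open>P\<close> annihilated this basis vector, so would \<open>X\<close>;
      hence some code vector overlaps it, and \<open>S \<inter> x\<close> lies in its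
      support.\<close>
    have "P *v ?e \<noteq> 0" using kernel nz by (metis zero_index)
    then obtain \<phi> where "\<phi> \<in> C" "braket \<phi> ?e \<noteq> 0"
      using projector_kills[OF P e] by blast
    then have "of_nat (card (S \<inter> x)) = c" using C by (auto simp: braket_axis)
    with R show ?thesis by (metis of_nat_eq_iff)
  qed
  then have "(- 1) ^ (card (R \<inter> x) + card (S \<inter> x)) * X $ R $ S = X $ R $ S" for R S
    by (cases "X $ R $ S = 0") simp_all
  then show ?thesis by (simp add: parity_twist_def vec_eq_iff)
qed

text \<open>Both \<open>P\<close> and \<open>A ** P\<close> satisfy the range and kernel conditions
  of \<open>even_on_code_space\<close>. For \<open>A ** P\<close>, the range condition is logicality
  in the form \<open>A ** P = P ** (A ** P)\<close>, and the kernel condition holds because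
  \<open>P\<close> acts first.\<close>

lemma code_operators_even:
  assumes "codestates x L0 L1" and P: "is_code_projector x (code_space L0 L1) P"
    and num: "\<exists>m. total_num x *v L0 = m *s L0" "\<exists>m. total_num x *v L1 = m *s L1"
    and "\<And>j. j \<in> x \<Longrightarrow> detects P (num j)"
    and O: "A \<in> block_algebra x" "logical P A"
  shows "parity_twist x P = P" "parity_twist x (A ** P) = A ** P"
proof -
  let ?C = "code_space L0 L1"
  from num obtain m0 m1 where "total_num x *v L0 = m0 *s L0" "total_num x *v L1 = m1 *s L1"
    by blast
  from code_space_particle_number[OF assms(1) P this assms(5)] obtain c :: complex
    where C: "\<And>\<phi> S. \<phi> \<in> ?C \<Longrightarrow> \<phi> $ S \<noteq> 0 \<Longrightarrow> S \<subseteq> x \<and> of_nat (card S) = c"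
    by blast
  have Pin: "P \<in> block_algebra x" and PC: "\<And>\<psi>. \<psi> \<in> block_fock x \<Longrightarrow> P *v \<psi> \<in> ?C"
    using P by (auto simp: is_code_projector_def)
  show "parity_twist x P = P"
    using block_algebra_local[OF Pin] P C PC by (rule even_on_code_space)
  have loc: "block_local x (A ** P)"
    by (intro block_algebra_local block_algebra.mult O Pin)
  have PAP: "A ** P = P ** (A ** P)"
    using O(2) by (simp add: logical_def vec_eq_iff matrix_minus_eq matrix_add_rdistrib mat_mult_nth
        flip: matrix_mul_assoc)
  show "parity_twist x (A ** P) = A ** P"
  proof (rule even_on_code_space[OF loc P C])
    fix \<psi> assume "\<psi> \<in> block_fock x"
    then have "P *v ((A ** P) *v \<psi>) \<in> ?C" by (intro PC block_fock_invariant[OF loc])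
    then show "(A ** P) *v \<psi> \<in> ?C"
      using PAP by (simp add: matrix_vector_mul_assoc)
  next
    fix \<psi> assume "P *v \<psi> = 0"
    then show "(A ** P) *v \<psi> = 0" by (simp add: matrix_vector_mul_assoc[symmetric])
  qed auto
qed

theorem mainTheorem1:
  fixes a b :: "'s::{finite,linorder} set"
    and L0 L1 :: "'s set \<Rightarrow> 's fock"
    and P :: "'s set \<Rightarrow> 's fop"
  assumes disjoint: "a \<inter> b = {}"
    and sites: "a \<union> b = UNIV"
    and codestates: "\<And>x. x \<in> {a, b} \<Longrightarrow> codestates x (L0 x) (L1 x)"
    and projector: "\<And>x. x \<in> {a, b} \<Longrightarrow> is_code_projector x (code_space (L0 x) (L1 x)) (P x)"
    and number_eigenstates: "\<And>x. x \<in> {a, b} \<Longrightarrow>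
      (\<exists>m. total_num x *v L0 x = m *s L0 x) \<and> (\<exists>m. total_num x *v L1 x = m *s L1 x)"
    and phase_errors: "\<And>x j. x \<in> {a, b} \<Longrightarrow> j \<in> x \<Longrightarrow> detects (P x) (num j)"
  shows "\<not> (\<exists>Oa \<in> block_algebra a. \<exists>Ob \<in> block_algebra b.
      logical (P a) Oa \<and> logical (P b) Ob \<and> Oa ** P a \<noteq> 0 \<and> Ob ** P b \<noteq> 0 \<and>
      (Oa ** Ob + Ob ** Oa) ** P a ** P b = 0)"
proof
  assume "\<exists>Oa \<in> block_algebra a. \<exists>Ob \<in> block_algebra b.
      logical (P a) Oa \<and> logical (P b) Ob \<and> Oa ** P a \<noteq> 0 \<and> Ob ** P b \<noteq> 0 \<and>
      (Oa ** Ob + Ob ** Oa) ** P a ** P b = 0"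
  then obtain Oa Ob where Oa: "Oa \<in> block_algebra a" "logical (P a) Oa" "Oa ** P a \<noteq> 0"
    and Ob: "Ob \<in> block_algebra b" "logical (P b) Ob" "Ob ** P b \<noteq> 0"
    and anti: "(Oa ** Ob + Ob ** Oa) ** P a ** P b = 0"
    by blast
  have P: "P a \<in> block_algebra a" "P b \<in> block_algebra b"
    using projector by (auto simp: is_code_projector_def)
  have even: "parity_twist a (P a) = P a" "parity_twist a (Oa ** P a) = Oa ** P a"
    using code_operators_even[of a "L0 a" "L1 a" "P a" Oa]
      codestates projector number_eigenstates phase_errors Oa by auto
  let ?X = "Oa ** P a" and ?Y = "Ob ** P b"
  have X: "?X \<in> block_algebra a" and Y: "?Y \<in> block_algebra b"
    using Oa Ob P by (auto intro: block_algebra.mult)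
  \<comment> \<open>Evenness of \<open>P a\<close> lets it pass to the left of
    \<open>Ob\<close>.\<close>
  have "Oa ** Ob ** P a ** P b = ?X ** ?Y"
    using even_commutes[OF P(1) even(1) disjoint Ob(1)] by (metis matrix_mul_assoc)
  \<comment> \<open>Here \<open>Ob\<close> moves past the whole even operator
    \<open>Oa ** P a\<close>. Both orders thus give the same product with the same sign, and the
    anticommutator is twice that product.\<close>
  moreover have "Ob ** Oa ** P a ** P b = ?X ** ?Y"
    using even_commutes[OF X even(2) disjoint Ob(1)] by (metis matrix_mul_assoc)
  ultimately have "?X ** ?Y + ?X ** ?Y = 0"
    using anti by (simp add: matrix_add_rdistrib)
  then have "?X ** ?Y = 0" by (simp add: vec_eq_iff)
  moreover have "?X ** ?Y \<noteq> 0"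
    using block_algebra_local[OF X] block_algebra_local[OF Y] disjoint sites Oa(3) Ob(3)
    by (rule block_local_product_nonzero)
  ultimately show False by contradiction
qed

end
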